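(* Let $n\geq 3$, let $K$ be an infinite integral domain, and let $G$ be the general linear group ${\rm GL}_n(K)$ or the special linear group ${\rm SL}_n(K)$. Let $\Phi$ be the subgroup of ${\rm Aut}(G)$ generated by all inner automorphisms, all central automorphisms and the contragradient automorphism of $G$ (in the sense defined in the context). Then for every automorphism $\varphi\in\Phi$ the number of $\varphi$-conjugacy classes in $G$ is infinite. In particular, if $K$ is such that $\Phi={\rm Aut}(G)$, then $G$ possesses the $R_\infty$-property.
   Context: An integral domain is a commutative ring with unit element and without zero divisors. Twisted conjugacy: for a group $G$ and an automorphism $\varphi:G\to G$, elements $x,y\in G$ are $\varphi$-conjugated if there is $c\in G$ with $x=c\,y\,\varphi(c^{-1})$. This is an equivalence relation, whose classes are the $\varphi$-conjugacy classes; their number $R(\varphi)$ is the Reidemeister number of $\varphi$. The group $G$ possesses the $R_\infty$-property if $R(\varphi)$ is infinite for every automorphism $\varphi$ of $G$. Automorphisms of $G={\rm GL}_n(K)$ or ${\rm SL}_n(K)$: (1) Inner automorphisms: $\varphi_D:A\mapsto DAD^{-1}$, where $D\in{\rm GL}_n(K)$ is arbitrary (these are called inner also when $G={\rm SL}_n(K)$, even if $D\notin{\rm SL}_n(K)$). (2) The contragradient automorphism: $\Lambda:A\mapsto (A^T)^{-1}$, where $A^T$ is the transpose of $A$. (3) Central automorphisms: automorphisms of $G$ of the form $\Gamma:A\mapsto\gamma(A)A$, where $\gamma:G\to Z(G)$ is a homomorphism of $G$ into its center $Z(G)$ (which consists of the scalar matrices in $G$). *)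

theory Defs
  imports
    "Jordan_Normal_Form.Determinant"
    "HOL-Algebra.Bij"
    "HOL-Algebra.Generated_Groups"
begin

definition twisted_conj :: "('g, 'r) monoid_scheme \<Rightarrow> ('g \<Rightarrow> 'g) \<Rightarrow> ('g \<times> 'g) set" where
  "twisted_conj G \<phi> =
     {(x, y). x \<in> carrier G \<and> y \<in> carrier G \<and>
        (\<exists>c\<in>carrier G. x = c \<otimes>\<^bsub>G\<^esub> y \<otimes>\<^bsub>G\<^esub> \<phi> (inv\<^bsub>G\<^esub> c))}"

definition twisted_conj_classes :: "('g, 'r) monoid_scheme \<Rightarrow> ('g \<Rightarrow> 'g) \<Rightarrow> 'g set set" where
  "twisted_conj_classes G \<phi> = carrier G // twisted_conj G \<phi>"

definition R_infinity :: "('g, 'r) monoid_scheme \<Rightarrow> bool" where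
  "R_infinity G \<longleftrightarrow> (\<forall>\<phi>\<in>auto G. infinite (twisted_conj_classes G \<phi>))"

definition center :: "('g, 'r) monoid_scheme \<Rightarrow> 'g set" where
  "center G = {z \<in> carrier G. \<forall>x\<in>carrier G. z \<otimes>\<^bsub>G\<^esub> x = x \<otimes>\<^bsub>G\<^esub> z}"

definition GL :: "nat \<Rightarrow> 'k::idom mat monoid" where
  "GL n = units_of (ring_mat TYPE('k) n ())"

definition SL :: "nat \<Rightarrow> 'k::idom mat monoid" where
  "SL n = (GL n)\<lparr>carrier := {A \<in> carrier_mat n n. det A = 1}\<rparr>"

text \<open>
  As \<^const>\<open>auto\<close> consists of extensional functions, the automorphisms below are restricted
  to the carrier of \<open>G\<close>, which is meant to be \<open>GL n\<close> or \<open>SL n\<close>. The conjugating matrix of an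
  inner automorphism ranges over \<open>GL n\<close> in both cases.
\<close>

definition inner_automorphisms :: "nat \<Rightarrow> 'k::idom mat monoid \<Rightarrow> ('k mat \<Rightarrow> 'k mat) set" where
  "inner_automorphisms n G =
     {\<lambda>A\<in>carrier G. D * A * inv\<^bsub>GL n\<^esub> D | D. D \<in> carrier (GL n)}"

definition contragradient :: "'k::idom mat monoid \<Rightarrow> 'k mat \<Rightarrow> 'k mat" where
  "contragradient G = (\<lambda>A\<in>carrier G. inv\<^bsub>G\<^esub> (transpose_mat A))"

definition central_automorphisms :: "('g, 'r) monoid_scheme \<Rightarrow> ('g \<Rightarrow> 'g) set" where
  "central_automorphisms G =
     {\<phi> \<in> auto G. \<exists>\<gamma>\<in>hom G (G\<lparr>carrier := center G\<rparr>). \<forall>A\<in>carrier G. \<phi> A = \<gamma> A \<otimes>\<^bsub>G\<^esub> A}"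

definition standard_automorphisms :: "nat \<Rightarrow> 'k::idom mat monoid \<Rightarrow> ('k mat \<Rightarrow> 'k mat) set" where
  "standard_automorphisms n G =
     generate (AutoGroup G)
       (inner_automorphisms n G \<union> central_automorphisms G \<union> {contragradient G})"

end

theory Submission
  imports Defs
begin

text \<open>
  Scalar matrices are harmless: modulo the center, every automorphism in the group generated by the
  inner, central and contragradient ones has the shape \<open>A \<mapsto> D \<sigma>(A) D\<^sup>-\<^sup>1\<close>, where \<open>\<sigma>\<close> is the identity
  or the contragradient \<open>L\<close>. Maps of this shape are closed under composition and inversion because
  \<open>\<sigma>(D A D\<^sup>-\<^sup>1) = \<sigma>(D) \<sigma>(A) \<sigma>(D)\<^sup>-\<^sup>1\<close>, and central factors remain central; this is
  \<open>subgroup_standard_mod_center\<close>, and \<open>standard_automorphisms_mod_center\<close> applies it to matrices.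

  If \<open>x = c y \<phi>(c\<^sup>-\<^sup>1)\<close> for such a \<open>\<phi>\<close>, then \<open>M = y D\<close> and \<open>N = x D\<close> satisfy
  \<open>N = z c M \<sigma>(c\<^sup>-\<^sup>1)\<close> with \<open>z\<close> scalar (\<open>twisted_conj_mod_center\<close>). So twisted conjugacy of \<open>x\<close> and
  \<open>y\<close> makes \<open>M\<close> and \<open>N\<close> similar up to a scalar when \<open>\<sigma> = id\<close>, and congruent up to a scalar when
  \<open>\<sigma> = L\<close>, as \<open>L(c\<^sup>-\<^sup>1)\<close> is the transpose of \<open>c\<close>. Each relation has an invariant:

  \<^item> Similarity up to the scalar \<open>u\<close> multiplies the determinant by \<open>u\<^sup>n\<close> and the trace by \<open>u\<close>. Among
    matrices with the same nonzero determinant, the \<open>n\<close>-th power of the trace is therefore invariant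
    (\<open>scalar_conjugate_trace_power\<close>).
  \<^item> Congruence up to a scalar changes the cosquare \<open>M L(M)\<close> only by conjugation, for the scalar
    cancels (\<open>cosquare_conjugate\<close>). So the trace of the cosquare is invariant.

  For every matrix \<open>M\<close> with \<open>det M = det D\<close> the matrix \<open>y = M D\<^sup>-\<^sup>1\<close> has determinant 1, so it lies in
  both groups. It remains to choose such matrices \<open>M\<^sub>t\<close>, indexed by \<open>t\<close> in the domain, on which
  the invariant is a nonconstant polynomial in \<open>t\<close>: this takes infinitely many values on an
  infinite integral domain. With \<open>d = det D\<close>, the blocks with rows \<open>(t, -d), (1, 0)\<close> and
  \<open>(d, 0), (t, 1)\<close>, extended by an identity block, do this in the first and second case.
\<close>

section \<open>Twisted conjugacy classes\<close>

lemma infinite_quotient_of_separated_family: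
  assumes refl: "\<And>t. (g t, g t) \<in> r" and mem: "\<And>t. g t \<in> A"
    and sep: "\<And>s t. (g s, g t) \<in> r \<Longrightarrow> h s = h t"
    and inf: "infinite (range h)"
  shows "infinite (A // r)"
proof
  assume "finite (A // r)"
  moreover have "range (\<lambda>t. r `` {g t}) \<subseteq> A // r"
    using mem by (auto intro: quotientI)
  ultimately have fin: "finite (range (\<lambda>t. r `` {g t}))"
    by (rule rev_finite_subset)
  define f where "f X = h (SOME t. r `` {g t} = X)" for X
  have "h t = f (r `` {g t})" for t
  proof -
    have "r `` {g (SOME s. r `` {g s} = r `` {g t})} = r `` {g t}"
      by (rule someI) (rule HOL.refl)
    then show ?thesis
      unfolding f_def by (intro sym[OF sep]) (use refl in blast)
  qed
  then have "range h \<subseteq> f ` range (\<lambda>t. r `` {g t})"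
    by blast
  with fin inf show False
    by (meson finite_imageI finite_subset)
qed

text \<open>
  Reflexivity is the part of being an equivalence relation that lets one read off from the equality of
  two classes that their representatives are twisted conjugate.
\<close>

lemma (in group) twisted_conj_refl:
  assumes "\<phi> \<in> hom G G" "x \<in> carrier G"
  shows "(x, x) \<in> twisted_conj G \<phi>"
proof -
  have "x = \<one> \<otimes> x \<otimes> \<phi> (inv \<one>)"
    using assms hom_one[OF assms(1)] by simp
  then show ?thesis
    using assms unfolding twisted_conj_def by blast
qed

text \<open>
  Each value is taken only finitely often, since a nonzero polynomial over a domain has finitely many
  roots.
\<close>

lemma infinite_range_poly:
  fixes p :: "'a::idom poly"
  assumes "infinite (UNIV :: 'a set)" "degree p > 0"
  shows "infinite (range (poly p))"
proof
  assume fin: "finite (range (poly p))"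
  have "finite {x. poly p x = v}" for v
  proof -
    have "p - [:v:] \<noteq> 0"
      using assms(2) by auto
    from poly_roots_finite[OF this] show ?thesis
      by simp
  qed
  with fin have "finite (\<Union>v\<in>range (poly p). {x. poly p x = v})"
    by blast
  moreover have "(\<Union>v\<in>range (poly p). {x. poly p x = v}) = UNIV"
    by blast
  ultimately show False
    using assms(1) by simp
qed

section \<open>Automorphisms that are inner modulo the center\<close>

context group
begin

lemma center_subset: "z \<in> center G \<Longrightarrow> z \<in> carrier G"
  by (simp add: center_def)

lemma center_comm: "z \<in> center G \<Longrightarrow> x \<in> carrier G \<Longrightarrow> x \<otimes> z = z \<otimes> x"
  by (simp add: center_def)

lemma center_lcomm:
  assumes "z \<in> center G" "x \<in> carrier G" "y \<in> carrier G"
  shows "x \<otimes> (z \<otimes> y) = z \<otimes> (x \<otimes> y)"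
  using assms center_comm[OF assms(1,2)] center_subset[OF assms(1)]
  by (simp flip: m_assoc)

lemma center_one: "\<one> \<in> center G"
  by (simp add: center_def)

lemma center_mult:
  assumes "z \<in> center G" "w \<in> center G"
  shows "z \<otimes> w \<in> center G"
proof -
  have "(z \<otimes> w) \<otimes> x = x \<otimes> (z \<otimes> w)" if "x \<in> carrier G" for x
    using assms that center_subset center_comm[OF assms(2) that] center_lcomm[OF assms(1) that, of w]
    by (simp add: m_assoc)
  then show ?thesis
    using assms[THEN center_subset] by (simp add: center_def)
qed

lemma center_inv:
  assumes "z \<in> center G"
  shows "inv z \<in> center G"
proof -
  have "inv z \<otimes> x = x \<otimes> inv z" if x: "x \<in> carrier G" for x
  proof -
    have z: "z \<in> carrier G"
      using assms by (rule center_subset)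
    have "inv z \<otimes> x = inv z \<otimes> (x \<otimes> z) \<otimes> inv z"
      using x z by (simp add: m_assoc)
    also have "\<dots> = inv z \<otimes> (z \<otimes> x) \<otimes> inv z"
      using center_comm[OF assms x] by simp
    also have "\<dots> = x \<otimes> inv z"
      using x z by (simp flip: m_assoc)
    finally show ?thesis .
  qed
  then show ?thesis
    using center_subset[OF assms] by (simp add: center_def)
qed

lemma cancel_inv_left:
  assumes "x \<in> carrier G" "y \<in> carrier G"
  shows "inv x \<otimes> (x \<otimes> y) = y" "x \<otimes> (inv x \<otimes> y) = y"
  using assms by (simp_all flip: m_assoc)

text \<open>
  An endomorphism of the whole group restricts to an automorphism of a subgroup as soon as it can be
  undone there. This covers conjugation of the special linear group by matrices of any determinant.
\<close>

lemma restrict_in_auto: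
  assumes "subgroup K G" "\<tau> \<in> hom G G"
    and "\<And>x. x \<in> K \<Longrightarrow> \<tau> x \<in> K" "\<And>x. x \<in> K \<Longrightarrow> \<tau>' x \<in> K"
    and "\<And>x. x \<in> K \<Longrightarrow> \<tau>' (\<tau> x) = x" "\<And>x. x \<in> K \<Longrightarrow> \<tau> (\<tau>' x) = x"
  shows "(\<lambda>x\<in>K. \<tau> x) \<in> auto (G\<lparr>carrier := K\<rparr>)"
proof -
  have "bij_betw \<tau> K K"
    by (rule bij_betw_byWitness[where f' = \<tau>']) (use assms in auto)
  then have "bij_betw (\<lambda>x\<in>K. \<tau> x) K K"
    by (rule bij_betw_cong[THEN iffD1, rotated]) simp
  moreover have "(\<lambda>x\<in>K. \<tau> x) \<in> hom (G\<lparr>carrier := K\<rparr>) (G\<lparr>carrier := K\<rparr>)"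
    using assms subgroup.mem_carrier[OF assms(1)] subgroup.m_closed[OF assms(1)]
    by (auto simp: hom_def)
  ultimately show ?thesis
    by (simp add: auto_def Bij_def)
qed

end

text \<open>
  The contragradient automorphism enters the group theory only as an involutive automorphism.
\<close>

locale group_involution = group +
  fixes L :: "'a \<Rightarrow> 'a"
  assumes L_hom: "L \<in> hom G G"
    and L_L: "x \<in> carrier G \<Longrightarrow> L (L x) = x"
begin

lemma L_closed [simp]: "x \<in> carrier G \<Longrightarrow> L x \<in> carrier G"
  using L_hom by (auto simp: hom_def)

lemma L_mult: "x \<in> carrier G \<Longrightarrow> y \<in> carrier G \<Longrightarrow> L (x \<otimes> y) = L x \<otimes> L y"
  using L_hom by (auto simp: hom_def)

lemma L_inv: "x \<in> carrier G \<Longrightarrow> L (inv x) = inv (L x)"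
  using group_hom.hom_inv[of G G L x] L_hom
  by (simp add: group_hom_def group_hom_axioms_def)

lemma L_center:
  assumes "z \<in> center G"
  shows "L z \<in> center G"
proof -
  have "L z \<otimes> x = x \<otimes> L z" if "x \<in> carrier G" for x
  proof -
    have "L z \<otimes> L (L x) = L (L x) \<otimes> L z"
      using center_comm[OF assms, of "L x"] that center_subset[OF assms]
      by (metis L_closed L_mult)
    with that show ?thesis
      by (simp add: L_L)
  qed
  then show ?thesis
    using center_subset[OF assms] by (simp add: center_def)
qed

text \<open>
  A Boolean exponent for \<open>L\<close>: the exponents add modulo 2 under composition, so that the two shapes
  of automorphisms are treated by one computation.
\<close>

definition twist :: "bool \<Rightarrow> 'a \<Rightarrow> 'a" where
  "twist \<epsilon> x = (if \<epsilon> then L x else x)"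

lemma twist_simps:
  assumes "x \<in> carrier G"
  shows "twist \<epsilon> x \<in> carrier G"
    and "y \<in> carrier G \<Longrightarrow> twist \<epsilon> (x \<otimes> y) = twist \<epsilon> x \<otimes> twist \<epsilon> y"
    and "twist \<epsilon> (inv x) = inv (twist \<epsilon> x)"
    and "twist \<epsilon> (twist \<delta> x) = twist (\<epsilon> \<noteq> \<delta>) x"
    and "x \<in> center G \<Longrightarrow> twist \<epsilon> x \<in> center G"
  using assms by (auto simp: twist_def L_mult L_inv L_L L_center)

text \<open>
  The conjugating element comes from the ambient group so that the special linear group may be
  conjugated by matrices of any determinant. The central factor is recorded pointwise: only its being
  central matters for the invariants of twisted conjugacy.
\<close>

definition standard_mod_center :: "'a set \<Rightarrow> ('a \<Rightarrow> 'a) set" where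
  "standard_mod_center K = {\<phi> \<in> auto (G\<lparr>carrier := K\<rparr>). \<exists>\<epsilon>. \<exists>D\<in>carrier G. \<forall>A\<in>K. \<exists>z\<in>center G.
     \<phi> A = z \<otimes> (D \<otimes> twist \<epsilon> A \<otimes> inv D)}"

text \<open>
  Conjugation by \<open>D\<close> after \<open>\<sigma>\<close>, applied after conjugation by \<open>E\<close> after \<open>\<tau>\<close>, is conjugation by
  \<open>D \<sigma>(E)\<close> after \<open>\<sigma>\<tau>\<close>. The inner central factor survives as its image under \<open>\<sigma>\<close>.
\<close>

lemma standard_mod_center_compose:
  assumes "subgroup K G" "\<phi> \<in> standard_mod_center K" "\<psi> \<in> standard_mod_center K"
    and auto: "compose K \<phi> \<psi> \<in> auto (G\<lparr>carrier := K\<rparr>)"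
  shows "compose K \<phi> \<psi> \<in> standard_mod_center K"
proof -
  note KG = subgroup.mem_carrier[OF assms(1)]
  obtain \<epsilon> D where D: "D \<in> carrier G"
    and \<phi>: "\<And>A. A \<in> K \<Longrightarrow> \<exists>z\<in>center G. \<phi> A = z \<otimes> (D \<otimes> twist \<epsilon> A \<otimes> inv D)"
    using assms(2) unfolding standard_mod_center_def by blast
  obtain \<delta> E where E: "E \<in> carrier G"
    and \<psi>: "\<And>A. A \<in> K \<Longrightarrow> \<exists>z\<in>center G. \<psi> A = z \<otimes> (E \<otimes> twist \<delta> A \<otimes> inv E)"
    using assms(3) unfolding standard_mod_center_def by blast
  have mapsto: "\<psi> A \<in> K" if "A \<in> K" for A
    using assms(3) that unfolding standard_mod_center_def auto_def by (auto simp: hom_def)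
  let ?F = "D \<otimes> twist \<epsilon> E"
  have "\<exists>z\<in>center G. compose K \<phi> \<psi> A = z \<otimes> (?F \<otimes> twist (\<epsilon> \<noteq> \<delta>) A \<otimes> inv ?F)"
    if A: "A \<in> K" for A
  proof -
    obtain w where w: "w \<in> center G" "\<psi> A = w \<otimes> (E \<otimes> twist \<delta> A \<otimes> inv E)"
      using \<psi>[OF A] by blast
    obtain z where z: "z \<in> center G" "\<phi> (\<psi> A) = z \<otimes> (D \<otimes> twist \<epsilon> (\<psi> A) \<otimes> inv D)"
      using \<phi>[OF mapsto[OF A]] by blast
    have [simp]: "D \<in> carrier G" "E \<in> carrier G" "A \<in> carrier G" "z \<in> carrier G" "w \<in> carrier G"
      using D E A KG w z center_subset by auto
    define Y where "Y = twist \<epsilon> E \<otimes> twist (\<epsilon> \<noteq> \<delta>) A \<otimes> inv (twist \<epsilon> E)"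
    have Y [simp]: "Y \<in> carrier G"
      by (simp add: Y_def twist_simps)
    have w' [simp]: "twist \<epsilon> w \<in> center G" "twist \<epsilon> w \<in> carrier G"
      using w(1) by (simp_all add: twist_simps)
    have "twist \<epsilon> (\<psi> A) = twist \<epsilon> w \<otimes> Y"
      unfolding w(2) Y_def by (simp add: twist_simps)
    then have "\<phi> (\<psi> A) = z \<otimes> (D \<otimes> (twist \<epsilon> w \<otimes> Y) \<otimes> inv D)"
      using z(2) by simp
    also have "\<dots> = (z \<otimes> twist \<epsilon> w) \<otimes> (D \<otimes> Y \<otimes> inv D)"
      by (simp add: center_lcomm[of "twist \<epsilon> w" D] m_assoc)
    also have "D \<otimes> Y \<otimes> inv D = ?F \<otimes> twist (\<epsilon> \<noteq> \<delta>) A \<otimes> inv ?F"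
      by (simp add: Y_def twist_simps(1) m_assoc inv_mult_group)
    finally show ?thesis
      using A z(1) w(1) by (auto simp: compose_def twist_simps intro!: center_mult)
  qed
  moreover have "?F \<in> carrier G"
    using D E by (simp add: twist_simps)
  ultimately show ?thesis
    unfolding standard_mod_center_def using auto by blast
qed

text \<open>
  Solving \<open>A = z D \<sigma>(B) D\<^sup>-\<^sup>1\<close> for \<open>B\<close> by applying the involution \<open>\<sigma>\<close> gives the same shape again,
  with \<open>\<sigma>(D\<^sup>-\<^sup>1)\<close> as the conjugating element.
\<close>

lemma standard_mod_center_inverse:
  assumes "subgroup K G" "\<phi> \<in> standard_mod_center K"
    and auto: "restrict (inv_into K \<phi>) K \<in> auto (G\<lparr>carrier := K\<rparr>)"
  shows "restrict (inv_into K \<phi>) K \<in> standard_mod_center K"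
proof -
  note KG = subgroup.mem_carrier[OF assms(1)]
  obtain \<epsilon> D where D: "D \<in> carrier G"
    and \<phi>: "\<And>A. A \<in> K \<Longrightarrow> \<exists>z\<in>center G. \<phi> A = z \<otimes> (D \<otimes> twist \<epsilon> A \<otimes> inv D)"
    using assms(2) unfolding standard_mod_center_def by blast
  have surj: "\<phi> ` K = K"
    using assms(2) by (auto simp: standard_mod_center_def auto_def Bij_def bij_betw_def)
  let ?F = "twist \<epsilon> (inv D)"
  have "\<exists>z\<in>center G. restrict (inv_into K \<phi>) K A = z \<otimes> (?F \<otimes> twist \<epsilon> A \<otimes> inv ?F)"
    if A: "A \<in> K" for A
  proof -
    define B where "B = inv_into K \<phi> A"
    have B: "B \<in> K" "\<phi> B = A"
      using A surj unfolding B_def by (auto intro: inv_into_into f_inv_into_f)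
    obtain z where z: "z \<in> center G" "A = z \<otimes> (D \<otimes> twist \<epsilon> B \<otimes> inv D)"
      using \<phi>[OF B(1)] B(2) by auto
    have [simp]: "D \<in> carrier G" "A \<in> carrier G" "B \<in> carrier G" "z \<in> carrier G"
      using D A B(1) KG z center_subset by auto
    have "twist \<epsilon> B = inv z \<otimes> (inv D \<otimes> A \<otimes> D)"
    proof -
      have "inv D \<otimes> A \<otimes> D = inv D \<otimes> (z \<otimes> (D \<otimes> twist \<epsilon> B \<otimes> inv D)) \<otimes> D"
        using z(2) by simp
      also have "\<dots> = z \<otimes> twist \<epsilon> B"
        using center_lcomm[OF z(1), of "inv D"]
        by (simp add: twist_simps m_assoc) (simp add: twist_simps flip: m_assoc)
      finally show ?thesis
        by (simp add: twist_simps flip: m_assoc)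
    qed
    then have "twist \<epsilon> (twist \<epsilon> B) = twist \<epsilon> (inv z) \<otimes> (?F \<otimes> twist \<epsilon> A \<otimes> inv ?F)"
      by (simp add: twist_simps)
    then have "B = twist \<epsilon> (inv z) \<otimes> (?F \<otimes> twist \<epsilon> A \<otimes> inv ?F)"
      by (simp add: twist_simps) (simp add: twist_def)
    then show ?thesis
      using A z(1) by (auto simp: B_def center_inv twist_simps intro!: bexI[of _ "twist \<epsilon> (inv z)"])
  qed
  moreover have "?F \<in> carrier G"
    using D by (simp add: twist_simps)
  ultimately show ?thesis
    unfolding standard_mod_center_def using auto by blast
qed

lemma subgroup_standard_mod_center:
  assumes K: "subgroup K G"
  shows "subgroup (standard_mod_center K) (AutoGroup (G\<lparr>carrier := K\<rparr>))"
proof -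
  let ?K = "G\<lparr>carrier := K\<rparr>"
  interpret K: group ?K
    by (rule subgroup_imp_group[OF K])
  interpret A: group "AutoGroup ?K"
    by (rule K.AutoGroup)
  have carr: "carrier (AutoGroup ?K) = auto ?K"
    by (simp add: AutoGroup_def)
  have mult: "\<phi> \<otimes>\<^bsub>AutoGroup ?K\<^esub> \<psi> = compose K \<phi> \<psi>" if "\<phi> \<in> auto ?K" "\<psi> \<in> auto ?K" for \<phi> \<psi>
    using that by (simp add: AutoGroup_def BijGroup_def auto_def)
  have inv: "inv\<^bsub>AutoGroup ?K\<^esub> \<phi> = restrict (inv_into K \<phi>) K" if "\<phi> \<in> auto ?K" for \<phi>
    using that group.m_inv_consistent[OF group_BijGroup K.subgroup_auto that]
      inv_BijGroup[of \<phi> K] by (simp add: AutoGroup_def auto_def)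
  have sub: "\<phi> \<in> auto ?K" if "\<phi> \<in> standard_mod_center K" for \<phi>
    using that by (simp add: standard_mod_center_def)
  show ?thesis
  proof (rule subgroup.intro)
    show "standard_mod_center K \<subseteq> carrier (AutoGroup ?K)"
      using sub carr by blast
    show "\<phi> \<otimes>\<^bsub>AutoGroup ?K\<^esub> \<psi> \<in> standard_mod_center K"
      if "\<phi> \<in> standard_mod_center K" "\<psi> \<in> standard_mod_center K" for \<phi> \<psi>
      using standard_mod_center_compose[OF K that] A.m_closed[of \<phi> \<psi>] that sub carr mult by auto
    show "inv\<^bsub>AutoGroup ?K\<^esub> \<phi> \<in> standard_mod_center K" if "\<phi> \<in> standard_mod_center K" for \<phi>
      using standard_mod_center_inverse[OF K that] A.inv_closed[of \<phi>] that sub carr inv by auto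
    have "\<one>\<^bsub>AutoGroup ?K\<^esub> = (\<lambda>x\<in>K. x)"
      by (simp add: AutoGroup_def BijGroup_def)
    moreover have "(\<lambda>x\<in>K. x) \<in> auto ?K"
      using K.id_in_auto by simp
    moreover have "\<exists>z\<in>center G. (\<lambda>x\<in>K. x) A = z \<otimes> (\<one> \<otimes> twist False A \<otimes> inv \<one>)" if "A \<in> K" for A
      using that subgroup.mem_carrier[OF K that] center_one
      by (auto simp: twist_def intro!: bexI[of _ \<one>])
    ultimately show "\<one>\<^bsub>AutoGroup ?K\<^esub> \<in> standard_mod_center K"
      unfolding standard_mod_center_def
      by (simp only: mem_Collect_eq) (blast intro: one_closed)
  qed
qed

text \<open>
  Multiplying by \<open>D\<close> on the right turns twisted conjugacy into an action of the ambient group: by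
  conjugation for the trivial twist, and by a form of congruence for \<open>L\<close>.
\<close>

lemma twisted_conj_mod_center:
  assumes K: "subgroup K G" and D: "D \<in> carrier G"
    and \<phi>: "\<And>A. A \<in> K \<Longrightarrow> \<exists>z\<in>center G. \<phi> A = z \<otimes> (D \<otimes> twist \<epsilon> A \<otimes> inv D)"
    and xy: "(x, y) \<in> twisted_conj (G\<lparr>carrier := K\<rparr>) \<phi>"
  shows "\<exists>c\<in>carrier G. \<exists>z\<in>center G. x \<otimes> D = z \<otimes> (c \<otimes> (y \<otimes> D) \<otimes> twist \<epsilon> (inv c))"
proof -
  obtain c where c: "c \<in> K" "x \<in> K" "y \<in> K" "x = c \<otimes> y \<otimes> \<phi> (inv c)"
    using xy m_inv_consistent[OF K] unfolding twisted_conj_def by auto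
  obtain z where z: "z \<in> center G" "\<phi> (inv c) = z \<otimes> (D \<otimes> twist \<epsilon> (inv c) \<otimes> inv D)"
    using \<phi>[OF subgroup.m_inv_closed[OF K c(1)]] by blast
  have [simp]: "D \<in> carrier G" "c \<in> carrier G" "y \<in> carrier G" "z \<in> carrier G"
    using D c subgroup.mem_carrier[OF K] z center_subset by auto
  have "x \<otimes> D = (c \<otimes> y) \<otimes> (z \<otimes> (D \<otimes> twist \<epsilon> (inv c) \<otimes> inv D)) \<otimes> D"
    using c(4) z(2) by simp
  also have "\<dots> = z \<otimes> ((c \<otimes> y) \<otimes> (D \<otimes> twist \<epsilon> (inv c) \<otimes> inv D)) \<otimes> D"
    using center_lcomm[OF z(1), of "c \<otimes> y"] by (simp add: twist_simps)
  also have "\<dots> = z \<otimes> (c \<otimes> (y \<otimes> D) \<otimes> twist \<epsilon> (inv c))"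
    by (simp add: twist_simps m_assoc)
  finally show ?thesis
    using z(1) by (intro bexI[of _ c] bexI[of _ z]) auto
qed

text \<open>
  In \<open>N L(N)\<close> the factor \<open>L(c\<^sup>-\<^sup>1)\<close> at the end of \<open>N\<close> meets \<open>L(c)\<close> at the beginning of \<open>L(N)\<close>, and
  \<open>z\<close> meets \<open>L(z) = z\<^sup>-\<^sup>1\<close>. For matrices, \<open>M L(M)\<close> is the cosquare of the bilinear form \<open>M\<close>.
\<close>

lemma cosquare_conjugate:
  assumes "c \<in> carrier G" "M \<in> carrier G" "z \<in> center G" "L z = inv z"
    and N: "N = z \<otimes> (c \<otimes> M \<otimes> L (inv c))"
  shows "N \<otimes> L N = c \<otimes> (M \<otimes> L M) \<otimes> inv c"
proof -
  have [simp]: "c \<in> carrier G" "M \<in> carrier G" "z \<in> carrier G"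
    using assms center_subset by auto
  have "L N = inv z \<otimes> (L c \<otimes> L M \<otimes> inv c)"
    using assms by (simp add: L_mult L_inv L_L)
  then have "N \<otimes> L N = z \<otimes> ((c \<otimes> M \<otimes> L (inv c)) \<otimes> (inv z \<otimes> (L c \<otimes> L M \<otimes> inv c)))"
    unfolding N by (simp add: m_assoc)
  also have "\<dots> = (c \<otimes> M \<otimes> L (inv c)) \<otimes> (L c \<otimes> L M \<otimes> inv c)"
    by (subst center_lcomm[OF center_inv[OF assms(3)]]) (simp_all add: inv_solve_left' flip: m_assoc)
  also have "\<dots> = c \<otimes> M \<otimes> (L (inv c) \<otimes> L c) \<otimes> L M \<otimes> inv c"
    by (simp add: m_assoc)
  also have "L (inv c) \<otimes> L c = \<one>"
    by (simp add: L_inv)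
  finally show ?thesis
    by (simp add: m_assoc)
qed

end


section \<open>The general linear group\<close>

lemma GL_mult [simp]: "x \<otimes>\<^bsub>GL n\<^esub> y = x * y"
  by (simp add: GL_def units_of_def ring_mat_simps)

lemma GL_one [simp]: "\<one>\<^bsub>GL n\<^esub> = 1\<^sub>m n"
  by (simp add: GL_def units_of_def ring_mat_simps)

lemma group_GL: "group (GL n :: 'k::idom mat monoid)"
proof -
  interpret ring "ring_mat TYPE('k) n ()"
    by (rule ring_mat)
  show ?thesis
    unfolding GL_def by (rule units_group)
qed

text \<open>
  If \<open>det A\<close> is a unit with inverse \<open>e\<close>, then \<open>e\<close> times the adjugate of \<open>A\<close> is the inverse of \<open>A\<close>.
\<close>

lemma GL_iff: "A \<in> carrier (GL n) \<longleftrightarrow> A \<in> carrier_mat n n \<and> det A dvd 1"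
proof
  assume "A \<in> carrier (GL n)"
  then obtain B where A: "A \<in> carrier_mat n n" and B: "B \<in> carrier_mat n n" and AB: "A * B = 1\<^sub>m n"
    by (auto simp: GL_def units_of_def Units_def ring_mat_simps)
  have "1 = det A * det B"
    using det_mult[OF A B] AB by simp
  with A show "A \<in> carrier_mat n n \<and> det A dvd 1"
    by (auto intro: dvdI)
next
  assume *: "A \<in> carrier_mat n n \<and> det A dvd 1"
  then obtain e where e: "1 = det A * e"
    by (auto elim: dvdE)
  let ?B = "e \<cdot>\<^sub>m adj_mat A"
  note A = conjunct1[OF *] and adj = adj_mat[OF conjunct1[OF *]]
  have "A * ?B = 1\<^sub>m n" "?B * A = 1\<^sub>m n"
    unfolding mult_smult_distrib[OF A adj(1)] mult_smult_assoc_mat[OF adj(1) A] adj(2,3)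
    by (rule eq_matI; use e in \<open>auto simp: mult.commute\<close>)+
  with A adj(1) show "A \<in> carrier (GL n)"
    by (auto simp: GL_def units_of_def Units_def ring_mat_simps intro!: bexI[of _ ?B])
qed

lemma transpose_GL:
  "A \<in> carrier (GL n) \<Longrightarrow> transpose_mat A \<in> carrier (GL n)"
  by (auto simp: GL_iff det_transpose)

lemma inv_transpose_GL:
  assumes A: "A \<in> carrier (GL n)"
  shows "inv\<^bsub>GL n\<^esub> (transpose_mat A) = transpose_mat (inv\<^bsub>GL n\<^esub> A)"
proof -
  interpret GL: group "GL n"
    by (rule group_GL)
  have "transpose_mat (inv\<^bsub>GL n\<^esub> A) * transpose_mat A = transpose_mat (A * inv\<^bsub>GL n\<^esub> A)"
    using A GL.inv_closed[OF A] by (subst transpose_mult) (auto simp: GL_iff)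
  also have "\<dots> = 1\<^sub>m n"
    using GL.r_inv[OF A] by simp
  finally show ?thesis
    using A by (intro GL.inv_equality) (auto intro!: transpose_GL)
qed

lemma group_involution_GL:
  "group_involution (GL n :: 'k::idom mat monoid) (\<lambda>A. inv\<^bsub>GL n\<^esub> (transpose_mat A))"
proof -
  interpret GL: group "GL n :: 'k mat monoid"
    by (rule group_GL)
  show ?thesis
  proof unfold_locales
    show "(\<lambda>A. inv\<^bsub>GL n\<^esub> (transpose_mat A)) \<in> hom (GL n :: 'k mat monoid) (GL n)"
    proof (rule homI)
      show "inv\<^bsub>GL n\<^esub> (transpose_mat A) \<in> carrier (GL n)" if "A \<in> carrier (GL n)" for A :: "'k mat"
        using that by (simp add: transpose_GL)
    next
      fix A B :: "'k mat"
      assume A: "A \<in> carrier (GL n)" and B: "B \<in> carrier (GL n)"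
      have "transpose_mat (A * B) = transpose_mat B * transpose_mat A"
        using A B by (subst transpose_mult) (auto simp: GL_iff)
      then show "inv\<^bsub>GL n\<^esub> (transpose_mat (A \<otimes>\<^bsub>GL n\<^esub> B)) =
          inv\<^bsub>GL n\<^esub> (transpose_mat A) \<otimes>\<^bsub>GL n\<^esub> inv\<^bsub>GL n\<^esub> (transpose_mat B)"
        using GL.inv_mult_group[OF transpose_GL[OF B] transpose_GL[OF A]] by simp
    qed
    show "inv\<^bsub>GL n\<^esub> (transpose_mat (inv\<^bsub>GL n\<^esub> (transpose_mat A))) = A"
      if "A \<in> carrier (GL n)" for A :: "'k mat"
      using that by (simp add: inv_transpose_GL[OF that] inv_transpose_GL transpose_GL)
  qed
qed

interpretation GL: group_involution "GL n" "\<lambda>A. inv\<^bsub>GL n\<^esub> (transpose_mat A)"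
  by (rule group_involution_GL)

lemma det_inv_GL:
  assumes "A \<in> carrier (GL n)"
  shows "det (inv\<^bsub>GL n\<^esub> A) * det A = 1"
proof -
  have "det (inv\<^bsub>GL n\<^esub> A) * det A = det (inv\<^bsub>GL n\<^esub> A * A)"
    using assms GL.inv_closed[OF assms] by (subst det_mult) (auto simp: GL_iff)
  also have "inv\<^bsub>GL n\<^esub> A * A = 1\<^sub>m n"
    using GL.l_inv[OF assms] by simp
  finally show ?thesis
    by simp
qed

lemma det_conjugate:
  assumes "D \<in> carrier (GL n)" "A \<in> carrier_mat n n"
  shows "det (D * A * inv\<^bsub>GL n\<^esub> D) = det A"
proof -
  have "inv\<^bsub>GL n\<^esub> D \<in> carrier_mat n n" "D \<in> carrier_mat n n"
    using assms GL.inv_closed[of D] by (auto simp: GL_iff)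
  then have "det (D * A * inv\<^bsub>GL n\<^esub> D) = det (inv\<^bsub>GL n\<^esub> D) * det D * det A"
    using assms(2) by (simp add: det_mult[where n = n])
  with det_inv_GL[OF assms(1)] show ?thesis
    by simp
qed

lemma SL_subset_GL: "A \<in> carrier_mat n n \<Longrightarrow> det A = 1 \<Longrightarrow> A \<in> carrier (GL n)"
  by (simp add: GL_iff)

lemma subgroup_SL: "subgroup {A \<in> carrier_mat n n. det A = 1} (GL n :: 'k::idom mat monoid)"
proof (rule GL.subgroupI)
  fix A :: "'k mat"
  assume "A \<in> {A \<in> carrier_mat n n. det A = 1}"
  then show "inv\<^bsub>GL n\<^esub> A \<in> {A \<in> carrier_mat n n. det A = 1}"
    using GL.inv_closed[of A n] det_inv_GL[of A n] by (auto simp: GL_iff)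
qed (auto simp: GL_iff det_mult[where n = n] intro!: exI[of _ "1\<^sub>m n"])

text \<open>
  The elementary matrices \<open>1 + E\<^sub>i\<^sub>j\<close> with \<open>i \<noteq> j\<close> lie in the special linear group; commuting with
  them already forces a matrix to be scalar.
\<close>

lemma scalar_if_commutes_with_SL:
  fixes z :: "'k::idom mat"
  assumes z: "z \<in> carrier_mat n n"
    and comm: "\<And>A. A \<in> carrier_mat n n \<Longrightarrow> det A = 1 \<Longrightarrow> z * A = A * z"
  shows "\<exists>u. z = u \<cdot>\<^sub>m 1\<^sub>m n"
proof -
  have entry: "z $$ (k, i) = (if k = i then z $$ (j, j) else 0)"
    if ij: "i < n" "j < n" "i \<noteq> j" and k: "k < n" for i j k
  proof -
    define E where "E = mat n n (\<lambda>(a, b). if a = i \<and> b = j then 1 else 0 :: 'k)"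
    have E: "E \<in> carrier_mat n n"
      by (simp add: E_def)
    have add: "1\<^sub>m n + E = addrow_mat n 1 i j"
      by (rule eq_matI) (use ij in \<open>auto simp: E_def\<close>)
    have "det (1\<^sub>m n + E) = 1"
      unfolding add using ij by (simp add: det_addrow_mat)
    then have "z * (1\<^sub>m n + E) = (1\<^sub>m n + E) * z"
      using E by (intro comm) auto
    then have "z + z * E = z + E * z"
      using z E by (simp add: mult_add_distrib_mat[OF z one_carrier_mat E]
        add_mult_distrib_mat[OF one_carrier_mat E z])
    then have "(z + z * E) $$ (k, j) = (z + E * z) $$ (k, j)"
      by simp
    then have "(z * E) $$ (k, j) = (E * z) $$ (k, j)"
      using z E ij k by simp
    moreover have "(z * E) $$ (k, j) = z $$ (k, i)"
      using z ij k by (simp add: E_def scalar_prod_def if_distrib cong: if_cong)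
    moreover have "(E * z) $$ (k, j) = (if k = i then z $$ (j, j) else 0)"
      using z ij k by (simp add: E_def scalar_prod_def if_distrib[of "\<lambda>x. x * _"] cong: if_cong)
    ultimately show ?thesis
      by simp
  qed
  have "z $$ (k, i) = (if k = i then z $$ (0, 0) else 0)" if "k < n" "i < n" for k i
  proof (cases "k = i")
    case True
    with entry[of k 0 k] that show ?thesis
      by (cases "k = 0") auto
  next
    case False
    with entry[of i k k] that show ?thesis
      by auto
  qed
  then obtain u where "\<And>k i. k < n \<Longrightarrow> i < n \<Longrightarrow> z $$ (k, i) = (if k = i then u else 0)"
    by blast
  then have "z = u \<cdot>\<^sub>m 1\<^sub>m n"
    using z by (intro eq_matI) auto
  then show ?thesis
    by blast
qed

lemma center_scalar:
  fixes K :: "'k::idom mat set"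
  assumes K: "subgroup K (GL n)" and SL: "{A \<in> carrier_mat n n. det A = 1} \<subseteq> K"
    and z: "z \<in> center ((GL n)\<lparr>carrier := K\<rparr>)"
  shows "\<exists>u. z = u \<cdot>\<^sub>m 1\<^sub>m n"
proof (rule scalar_if_commutes_with_SL)
  show "z \<in> carrier_mat n n"
    using z subgroup.mem_carrier[OF K] by (auto simp: center_def GL_iff)
  show "z * A = A * z" if "A \<in> carrier_mat n n" "det A = 1" for A
    using z SL that by (auto simp: center_def)
qed

text \<open>
  Central automorphisms are defined by the center of the group they act on, whereas the normal form
  of automorphisms refers to the center of the general linear group.
\<close>

lemma center_subset_center_GL:
  fixes K :: "'k::idom mat set"
  assumes "subgroup K (GL n)" "{A \<in> carrier_mat n n. det A = 1} \<subseteq> K"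
    and "z \<in> center ((GL n)\<lparr>carrier := K\<rparr>)"
  shows "z \<in> center (GL n)"
proof -
  obtain u where u: "z = u \<cdot>\<^sub>m 1\<^sub>m n"
    using center_scalar[OF assms] by blast
  have "z * x = x * z" if "x \<in> carrier_mat n n" for x
    unfolding u using that
    by (simp add: mult_smult_distrib[OF that one_carrier_mat] mult_smult_assoc_mat[OF one_carrier_mat that])
  moreover have "z \<in> carrier (GL n)"
    using assms(3) subgroup.mem_carrier[OF assms(1)] by (auto simp: center_def)
  ultimately show ?thesis
    by (simp add: center_def GL_iff)
qed

lemma center_GL_scalar:
  assumes "z \<in> center (GL n :: 'k::idom mat monoid)"
  shows "\<exists>u. z = u \<cdot>\<^sub>m 1\<^sub>m n"
  by (rule center_scalar[OF GL.subgroup_self]) (use assms in \<open>auto simp: GL_iff\<close>)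

section \<open>Standard automorphisms\<close>

text \<open>
  Each generator has the required shape, and the maps of this shape form a subgroup. Working with a
  subgroup \<open>K\<close> that is normal, closed under transposition and large enough to have only scalars in
  its center lets one argument serve both the general and the special linear group.
\<close>

lemma standard_automorphisms_mod_center:
  fixes K :: "'k::idom mat set"
  assumes K: "subgroup K (GL n)" and SL: "{A \<in> carrier_mat n n. det A = 1} \<subseteq> K"
    and conj: "\<And>D A. D \<in> carrier (GL n) \<Longrightarrow> A \<in> K \<Longrightarrow> D * A * inv\<^bsub>GL n\<^esub> D \<in> K"
    and trans: "\<And>A. A \<in> K \<Longrightarrow> transpose_mat A \<in> K"
  shows "standard_automorphisms n ((GL n)\<lparr>carrier := K\<rparr>) \<subseteq> GL.standard_mod_center n K"
    (is "standard_automorphisms n ?G \<subseteq> _")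
proof -
  note KG = subgroup.mem_carrier[OF K]
  have inner: "(\<lambda>A\<in>K. D * A * inv\<^bsub>GL n\<^esub> D) \<in> GL.standard_mod_center n K"
    if D: "D \<in> carrier (GL n)" for D
  proof -
    have D': "inv\<^bsub>GL n\<^esub> D \<in> carrier (GL n)"
      using D by simp
    have hom: "(\<lambda>A. D \<otimes>\<^bsub>GL n\<^esub> A \<otimes>\<^bsub>GL n\<^esub> inv\<^bsub>GL n\<^esub> D) \<in> hom (GL n) (GL n)"
      using D by (intro homI) (simp_all del: GL_mult GL_one add: GL.m_assoc GL.cancel_inv_left)
    have "(\<lambda>A\<in>K. D \<otimes>\<^bsub>GL n\<^esub> A \<otimes>\<^bsub>GL n\<^esub> inv\<^bsub>GL n\<^esub> D) \<in> auto ?G"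
    proof (rule GL.restrict_in_auto[OF K hom,
        where \<tau>' = "\<lambda>A. inv\<^bsub>GL n\<^esub> D \<otimes>\<^bsub>GL n\<^esub> A \<otimes>\<^bsub>GL n\<^esub> D"])
      fix A
      assume A: "A \<in> K"
      note [simp] = D KG[OF A]
      show "D \<otimes>\<^bsub>GL n\<^esub> A \<otimes>\<^bsub>GL n\<^esub> inv\<^bsub>GL n\<^esub> D \<in> K"
        using conj[OF D A] by simp
      show "inv\<^bsub>GL n\<^esub> D \<otimes>\<^bsub>GL n\<^esub> A \<otimes>\<^bsub>GL n\<^esub> D \<in> K"
        using conj[OF D' A] by simp
      show "inv\<^bsub>GL n\<^esub> D \<otimes>\<^bsub>GL n\<^esub> (D \<otimes>\<^bsub>GL n\<^esub> A \<otimes>\<^bsub>GL n\<^esub> inv\<^bsub>GL n\<^esub> D) \<otimes>\<^bsub>GL n\<^esub> D = A"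
        by (simp del: GL_mult GL_one add: GL.m_assoc GL.cancel_inv_left)
      show "D \<otimes>\<^bsub>GL n\<^esub> (inv\<^bsub>GL n\<^esub> D \<otimes>\<^bsub>GL n\<^esub> A \<otimes>\<^bsub>GL n\<^esub> D) \<otimes>\<^bsub>GL n\<^esub> inv\<^bsub>GL n\<^esub> D = A"
        by (simp del: GL_mult GL_one add: GL.m_assoc GL.cancel_inv_left)
    qed
    then have auto: "(\<lambda>A\<in>K. D * A * inv\<^bsub>GL n\<^esub> D) \<in> auto ?G"
      by simp
    have "\<exists>z\<in>center (GL n). (\<lambda>A\<in>K. D * A * inv\<^bsub>GL n\<^esub> D) A
        = z \<otimes>\<^bsub>GL n\<^esub> (D \<otimes>\<^bsub>GL n\<^esub> GL.twist n False A \<otimes>\<^bsub>GL n\<^esub> inv\<^bsub>GL n\<^esub> D)" if A: "A \<in> K" for A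
    proof (rule bexI[OF _ GL.center_one])
      show "(\<lambda>A\<in>K. D * A * inv\<^bsub>GL n\<^esub> D) A =
          \<one>\<^bsub>GL n\<^esub> \<otimes>\<^bsub>GL n\<^esub> (D \<otimes>\<^bsub>GL n\<^esub> GL.twist n False A \<otimes>\<^bsub>GL n\<^esub> inv\<^bsub>GL n\<^esub> D)"
        using A GL.l_one[OF GL.m_closed[OF GL.m_closed[OF D KG[OF A]] D']] by (simp add: GL.twist_def)
    qed
    then show ?thesis
      unfolding GL.standard_mod_center_def using auto D by blast
  qed
  have inv_eq: "inv\<^bsub>?G\<^esub> (transpose_mat A) = inv\<^bsub>GL n\<^esub> (transpose_mat A)" if "A \<in> K" for A
    using GL.m_inv_consistent[OF K trans[OF that]] .
  have contragradient: "contragradient ?G \<in> GL.standard_mod_center n K"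
  proof -
    have L: "inv\<^bsub>GL n\<^esub> (transpose_mat A) \<in> K" if "A \<in> K" for A
      using subgroup.m_inv_closed[OF K trans[OF that]] .
    have eq: "contragradient ?G = (\<lambda>A\<in>K. inv\<^bsub>GL n\<^esub> (transpose_mat A))"
      unfolding contragradient_def using inv_eq by (auto simp: restrict_def)
    have auto: "contragradient ?G \<in> auto ?G"
      unfolding eq
      by (rule GL.restrict_in_auto[OF K GL.L_hom, where \<tau>' = "\<lambda>A. inv\<^bsub>GL n\<^esub> (transpose_mat A)"])
        (auto intro: L GL.L_L KG)
    have "\<exists>z\<in>center (GL n). contragradient ?G A
        = z \<otimes>\<^bsub>GL n\<^esub> (\<one>\<^bsub>GL n\<^esub> \<otimes>\<^bsub>GL n\<^esub> GL.twist n True A \<otimes>\<^bsub>GL n\<^esub> inv\<^bsub>GL n\<^esub> \<one>\<^bsub>GL n\<^esub>)"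
      if A: "A \<in> K" for A
      using A KG[OF L[OF A]]
      by (intro bexI[OF _ GL.center_one]) (simp add: eq GL.twist_def del: GL_mult GL_one)
    then show ?thesis
      unfolding GL.standard_mod_center_def using auto GL.one_closed by blast
  qed
  have central: "\<phi> \<in> GL.standard_mod_center n K" if \<phi>: "\<phi> \<in> central_automorphisms ?G" for \<phi>
  proof -
    obtain \<gamma> where auto: "\<phi> \<in> auto ?G" and \<gamma>: "\<gamma> \<in> hom ?G (?G\<lparr>carrier := center ?G\<rparr>)"
      and eq: "\<And>A. A \<in> K \<Longrightarrow> \<phi> A = \<gamma> A * A"
      using \<phi> by (auto simp: central_automorphisms_def)
    have "\<exists>z\<in>center (GL n). \<phi> A
        = z \<otimes>\<^bsub>GL n\<^esub> (\<one>\<^bsub>GL n\<^esub> \<otimes>\<^bsub>GL n\<^esub> GL.twist n False A \<otimes>\<^bsub>GL n\<^esub> inv\<^bsub>GL n\<^esub> \<one>\<^bsub>GL n\<^esub>)"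
      if A: "A \<in> K" for A
    proof (rule bexI)
      show "\<gamma> A \<in> center (GL n)"
        using \<gamma> A by (intro center_subset_center_GL[OF K SL]) (auto simp: hom_def)
      have "\<one>\<^bsub>GL n\<^esub> \<otimes>\<^bsub>GL n\<^esub> GL.twist n False A \<otimes>\<^bsub>GL n\<^esub> inv\<^bsub>GL n\<^esub> \<one>\<^bsub>GL n\<^esub> = A"
        using KG[OF A] by (simp add: GL.twist_def del: GL_mult GL_one)
      then show "\<phi> A = \<gamma> A \<otimes>\<^bsub>GL n\<^esub>
          (\<one>\<^bsub>GL n\<^esub> \<otimes>\<^bsub>GL n\<^esub> GL.twist n False A \<otimes>\<^bsub>GL n\<^esub> inv\<^bsub>GL n\<^esub> \<one>\<^bsub>GL n\<^esub>)"
        using eq[OF A] by simp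
    qed
    then show ?thesis
      unfolding GL.standard_mod_center_def using auto GL.one_closed by blast
  qed
  interpret G: group ?G
    by (rule GL.subgroup_imp_group[OF K])
  show ?thesis
    unfolding standard_automorphisms_def
  proof (rule group.generate_subgroup_incl[OF G.AutoGroup])
    show "subgroup (GL.standard_mod_center n K) (AutoGroup ?G)"
      by (rule GL.subgroup_standard_mod_center[OF K])
    show "inner_automorphisms n ?G \<union> central_automorphisms ?G \<union> {contragradient ?G}
        \<subseteq> GL.standard_mod_center n K"
      using inner contragradient central by (auto simp: inner_automorphisms_def)
  qed
qed

section \<open>Traces\<close>

definition mat_trace :: "'a::comm_monoid_add mat \<Rightarrow> 'a" where
  "mat_trace A = (\<Sum>i<dim_row A. A $$ (i, i))"

lemma mat_trace_smult:
  fixes u :: "'a::semiring_0"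
  shows "A \<in> carrier_mat n n \<Longrightarrow> mat_trace (u \<cdot>\<^sub>m A) = u * mat_trace A"
  by (simp add: mat_trace_def sum_distrib_left)

lemma mat_trace_commute:
  fixes A B :: "'a::comm_semiring_0 mat"
  assumes "A \<in> carrier_mat m n" "B \<in> carrier_mat n m"
  shows "mat_trace (A * B) = mat_trace (B * A)"
proof -
  have "mat_trace (A * B) = (\<Sum>i<m. \<Sum>j<n. A $$ (i, j) * B $$ (j, i))"
    using assms by (simp add: mat_trace_def scalar_prod_def atLeast0LessThan)
  also have "\<dots> = (\<Sum>j<n. \<Sum>i<m. B $$ (j, i) * A $$ (i, j))"
    by (subst sum.swap) (simp add: mult.commute)
  also have "\<dots> = mat_trace (B * A)"
    using assms by (simp add: mat_trace_def scalar_prod_def atLeast0LessThan)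
  finally show ?thesis .
qed

lemma mat_trace_conjugate:
  assumes c: "c \<in> carrier (GL n)" and M: "M \<in> carrier_mat n n"
  shows "mat_trace (c * M * inv\<^bsub>GL n\<^esub> c) = mat_trace M"
proof -
  note c' = GL.inv_closed[OF c]
  have C: "c \<in> carrier_mat n n" "inv\<^bsub>GL n\<^esub> c \<in> carrier_mat n n"
    using c c' by (auto simp: GL_iff)
  have "mat_trace (c * M * inv\<^bsub>GL n\<^esub> c) = mat_trace (inv\<^bsub>GL n\<^esub> c * (c * M))"
    using C M by (intro mat_trace_commute[of _ n n]) auto
  also have "inv\<^bsub>GL n\<^esub> c * (c * M) = (inv\<^bsub>GL n\<^esub> c * c) * M"
    using C M by (simp add: assoc_mult_mat[of _ n n _ n _ n])
  also have "inv\<^bsub>GL n\<^esub> c * c = 1\<^sub>m n"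
    using GL.l_inv[OF c] by simp
  finally show ?thesis
    using M by simp
qed

section \<open>Witnesses\<close>

definition mat2 :: "'a \<Rightarrow> 'a \<Rightarrow> 'a \<Rightarrow> 'a \<Rightarrow> 'a mat" where
  "mat2 a b c d = mat 2 2 (\<lambda>(i, j). if i = 0 then if j = 0 then a else b else if j = 0 then c else d)"

text \<open>
  The block sum with an identity matrix: it is multiplicative on \<open>2 \<times> 2\<close> matrices and keeps the
  determinant, so all computations with the witnesses happen in size 2.
\<close>

definition extend2 :: "nat \<Rightarrow> 'a::{zero,one} mat \<Rightarrow> 'a mat" where
  "extend2 n B = four_block_mat B (0\<^sub>m 2 (n - 2)) (0\<^sub>m (n - 2) 2) (1\<^sub>m (n - 2))"

lemma mat2_carrier [simp]: "mat2 a b c d \<in> carrier_mat 2 2"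
  by (simp add: mat2_def)

lemma extend2_carrier [simp]: "n \<ge> 2 \<Longrightarrow> B \<in> carrier_mat 2 2 \<Longrightarrow> extend2 n B \<in> carrier_mat n n"
  unfolding extend2_def by (intro carrier_matI) auto

lemma det_mat2: "det (mat2 a b c d) = a * d - b * (c::'a::comm_ring_1)"
  unfolding laplace_expansion_row[OF mat2_carrier zero_less_numeral]
  by (simp add: cofactor_def mat_delete_def mat2_def det_single numeral_2_eq_2)

lemma mat2_mult:
  "mat2 a b c d * mat2 a' b' c' d' =
     mat2 (a * a' + b * c') (a * b' + b * d') (c * a' + d * c') (c * b' + d * (d'::'a::comm_ring_1))"
  by (rule eq_matI) (auto simp: mat2_def scalar_prod_def numeral_2_eq_2)

lemma mat2_transpose: "transpose_mat (mat2 a b c d) = mat2 a c b d"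
  by (rule eq_matI) (auto simp: mat2_def)

lemma mat2_one: "mat2 1 0 0 1 = 1\<^sub>m 2"
  by (rule eq_matI) (auto simp: mat2_def less_2_cases_iff)

lemma extend2_mult:
  fixes A B :: "'a::comm_ring_1 mat"
  assumes "A \<in> carrier_mat 2 2" "B \<in> carrier_mat 2 2"
  shows "extend2 n A * extend2 n B = extend2 n (A * B)"
  unfolding extend2_def using assms
  by (subst mult_four_block_mat[of _ 2 2 _ "n - 2" _ "n - 2" _ _ 2 _ "n - 2"]) auto

lemma extend2_transpose:
  "A \<in> carrier_mat 2 2 \<Longrightarrow> transpose_mat (extend2 n A) = extend2 n (transpose_mat A)"
  unfolding extend2_def
  by (subst transpose_four_block_mat[of _ 2 2 _ "n - 2" _ "n - 2"]) auto

lemma extend2_one: "n \<ge> 2 \<Longrightarrow> extend2 n (1\<^sub>m 2) = 1\<^sub>m n"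
  unfolding extend2_def by (rule eq_matI) auto

lemma det_extend2:
  fixes A :: "'a::idom mat"
  assumes "A \<in> carrier_mat 2 2"
  shows "det (extend2 n A) = det A"
  unfolding extend2_def using assms
  by (subst det_four_block_mat_lower_left_zero[of _ 2 _ "n - 2"]) auto

lemma trace_extend2:
  fixes a b c d :: "'a::comm_ring_1"
  assumes "n \<ge> 2"
  shows "mat_trace (extend2 n (mat2 a b c d)) = a + d + of_nat (n - 2)"
proof -
  obtain m where n: "n = Suc (Suc m)"
    using le_Suc_ex[OF assms] by (auto simp: numeral_2_eq_2)
  have "mat_trace (extend2 n (mat2 a b c d)) =
      (\<Sum>i<Suc (Suc m). if i = 0 then a else if i = 1 then d else 1)"
    unfolding mat_trace_def
    by (rule sum.cong) (auto simp: n extend2_def mat2_def less_Suc_eq_0_disj)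
  also have "\<dots> = a + d + of_nat m"
    by (simp add: sum.lessThan_Suc_shift del: sum.lessThan_Suc)
  finally show ?thesis
    by (simp add: n)
qed

section \<open>Infinitely many twisted conjugacy classes\<close>

text \<open>
  Equality of the determinants forces \<open>u\<^sup>n = 1\<close>, which the \<open>n\<close>-th power of the trace no longer sees.
\<close>

lemma scalar_conjugate_trace_power:
  fixes u :: "'k::idom"
  assumes c: "c \<in> carrier (GL n)" and M: "M \<in> carrier_mat n n"
    and N: "N = (u \<cdot>\<^sub>m 1\<^sub>m n) * (c * M * inv\<^bsub>GL n\<^esub> c)"
    and det: "det N = det M" "det M \<noteq> 0"
  shows "mat_trace N ^ n = mat_trace M ^ n"
proof -
  have C: "c * M * inv\<^bsub>GL n\<^esub> c \<in> carrier_mat n n"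
    using c M GL.inv_closed[OF c] by (auto simp: GL_iff)
  have N': "N = u \<cdot>\<^sub>m (c * M * inv\<^bsub>GL n\<^esub> c)"
    unfolding N mult_smult_assoc_mat[OF one_carrier_mat C] left_mult_one_mat[OF C] ..
  have "det N = u ^ n * det M"
    unfolding N' using C by (simp add: det_conjugate[OF c M] carrier_matD(2)[OF C] del: index_mult_mat)
  with det have "u ^ n = 1"
    by simp
  moreover have "mat_trace N = u * mat_trace (c * M * inv\<^bsub>GL n\<^esub> c)"
    unfolding N' by (rule mat_trace_smult[OF C])
  ultimately show ?thesis
    by (simp add: mat_trace_conjugate[OF c M] power_mult_distrib)
qed

text \<open>
  The two cases share the reduction \<open>separate\<close>: it suffices to give matrices \<open>M t\<close> with the
  determinant of \<open>D\<close> and an invariant that is a nonconstant polynomial in \<open>t\<close>.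
\<close>

lemma infinite_twisted_conj_classes:
  fixes K :: "'k::idom mat set"
  assumes n: "n \<ge> 2" and inf: "infinite (UNIV :: 'k set)"
    and K: "subgroup K (GL n)" and SL: "{A \<in> carrier_mat n n. det A = 1} \<subseteq> K"
    and \<phi>: "\<phi> \<in> GL.standard_mod_center n K"
  shows "infinite (twisted_conj_classes ((GL n)\<lparr>carrier := K\<rparr>) \<phi>)"
proof -
  let ?G = "(GL n)\<lparr>carrier := K\<rparr>"
  let ?L = "\<lambda>A. inv\<^bsub>GL n\<^esub> (transpose_mat A)"
  let ?k = "of_nat (n - 2) :: 'k"
  interpret G: group ?G
    by (rule GL.subgroup_imp_group[OF K])
  obtain \<epsilon> D where hom: "\<phi> \<in> hom ?G ?G" and D: "D \<in> carrier (GL n)"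
    and \<phi>': "\<And>A. A \<in> K \<Longrightarrow> \<exists>z\<in>center (GL n).
      \<phi> A = z \<otimes>\<^bsub>GL n\<^esub> (D \<otimes>\<^bsub>GL n\<^esub> GL.twist n \<epsilon> A \<otimes>\<^bsub>GL n\<^esub> inv\<^bsub>GL n\<^esub> D)"
    using \<phi> unfolding GL.standard_mod_center_def auto_def by blast
  define d where "d = det D"
  obtain e where de: "d * e = 1"
    using D by (auto simp: GL_iff d_def elim: dvdE)
  then have d0: "d \<noteq> 0" and e0: "e \<noteq> 0"
    by auto
  have e1: "e dvd 1"
    using de by (metis dvd_triv_right)
  have D': "inv\<^bsub>GL n\<^esub> D \<in> carrier (GL n)"
    using D by simp
  have separate: "infinite (twisted_conj_classes ?G \<phi>)"
    if M: "\<And>t. M t \<in> carrier_mat n n" "\<And>t. det (M t) = d"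
      and p: "degree (p :: 'k poly) > 0"
      and sep: "\<And>s t c z. c \<in> carrier (GL n) \<Longrightarrow> z \<in> center (GL n) \<Longrightarrow>
        M s = z \<otimes>\<^bsub>GL n\<^esub> (c \<otimes>\<^bsub>GL n\<^esub> M t \<otimes>\<^bsub>GL n\<^esub> GL.twist n \<epsilon> (inv\<^bsub>GL n\<^esub> c)) \<Longrightarrow> poly p s = poly p t"
    for M p
  proof -
    have MG: "M t \<in> carrier (GL n)" for t
      using M[of t] D by (simp add: GL_iff d_def)
    define y where "y t = M t \<otimes>\<^bsub>GL n\<^esub> inv\<^bsub>GL n\<^esub> D" for t
    have yD: "y t \<otimes>\<^bsub>GL n\<^esub> D = M t" for t
      unfolding y_def using MG D by (simp add: GL.m_assoc del: GL_mult GL_one)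
    have "det (y t) = 1" for t
    proof -
      have "det (y t) = d * det (inv\<^bsub>GL n\<^esub> D)"
        unfolding y_def using M[of t] D' by (simp add: det_mult[where n = n] GL_iff)
      also have "\<dots> = 1"
        using det_inv_GL[OF D] by (simp add: d_def mult.commute)
      finally show ?thesis .
    qed
    moreover have "y t \<in> carrier_mat n n" for t
      using M(1)[of t] D' by (simp add: y_def GL_iff)
    ultimately have yK: "y t \<in> carrier ?G" for t
      using SL by auto
    show ?thesis
      unfolding twisted_conj_classes_def
    proof (rule infinite_quotient_of_separated_family[where g = y and h = "poly p"])
      show "(y t, y t) \<in> twisted_conj ?G \<phi>" for t
        by (rule G.twisted_conj_refl[OF hom yK])
      show "poly p s = poly p t" if "(y s, y t) \<in> twisted_conj ?G \<phi>" for s t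
        using GL.twisted_conj_mod_center[OF K D \<phi>' that] sep unfolding yD by blast
    qed (use yK infinite_range_poly[OF inf p] in auto)
  qed
  show ?thesis
  proof (cases \<epsilon>)
    case False
    \<comment> \<open>a companion block, so that trace and determinant can be prescribed independently\<close>
    define M where "M t = extend2 n (mat2 t (- d) 1 0)" for t
    show ?thesis
    proof (rule separate)
      show M: "M t \<in> carrier_mat n n" "det (M t) = d" for t
        using n by (simp_all add: M_def det_extend2 det_mat2)
      show "degree ([:?k, 1:] ^ n) > 0"
        using n by (simp add: degree_linear_power)
      fix s t c z
      assume c: "c \<in> carrier (GL n)" and z: "z \<in> center (GL n)"
        and eq: "M s = z \<otimes>\<^bsub>GL n\<^esub> (c \<otimes>\<^bsub>GL n\<^esub> M t \<otimes>\<^bsub>GL n\<^esub> GL.twist n \<epsilon> (inv\<^bsub>GL n\<^esub> c))"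
      obtain u where u: "z = u \<cdot>\<^sub>m 1\<^sub>m n"
        using center_GL_scalar[OF z] by blast
      have "M s = (u \<cdot>\<^sub>m 1\<^sub>m n) * (c * M t * inv\<^bsub>GL n\<^esub> c)"
        using eq u False by (simp add: GL.twist_def)
      from scalar_conjugate_trace_power[OF c M(1) this] have "mat_trace (M s) ^ n = mat_trace (M t) ^ n"
        using M(2) d0 by simp
      then show "poly ([:?k, 1:] ^ n) s = poly ([:?k, 1:] ^ n) t"
        using n by (simp add: M_def trace_extend2 add.commute)
    qed
  next
    case True
    \<comment> \<open>the cosquare of a symmetric matrix is the identity, so the asymmetry \<open>t\<close> is what counts\<close>
    define M where "M t = extend2 n (mat2 d 0 t 1)" for t
    show ?thesis
    proof (rule separate)
      show M: "M t \<in> carrier_mat n n" "det (M t) = d" for t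
        using n by (simp_all add: M_def det_extend2 det_mat2)
      show "degree [:?k + 2, 0, - e:] > 0"
        using e0 by simp
      have MG: "M t \<in> carrier (GL n)" for t
        using M[of t] D by (simp add: GL_iff d_def)
      have cosquare: "mat_trace (M t * ?L (M t)) = poly [:?k + 2, 0, - e:] t" for t
      proof -
        \<comment> \<open>the inverse of the transpose of \<open>M t\<close>\<close>
        let ?I = "extend2 n (mat2 e (- (e * t)) 0 1)"
        have "?I * transpose_mat (M t) = extend2 n (mat2 (e * d) (e * t - e * t) 0 1)"
          by (simp add: M_def extend2_transpose mat2_transpose extend2_mult mat2_mult)
        also have "\<dots> = 1\<^sub>m n"
          using n de by (simp add: mat2_one extend2_one mult.commute)
        finally have "?L (M t) = ?I"
          using n e1 by (intro GL.inv_equality transpose_GL MG) (simp_all add: GL_iff det_extend2 det_mat2)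
        then show ?thesis
          using n de by (simp add: M_def extend2_mult mat2_mult trace_extend2 algebra_simps)
      qed
      fix s t c z
      assume c: "c \<in> carrier (GL n)" and z: "z \<in> center (GL n)"
        and eq: "M s = z \<otimes>\<^bsub>GL n\<^esub> (c \<otimes>\<^bsub>GL n\<^esub> M t \<otimes>\<^bsub>GL n\<^esub> GL.twist n \<epsilon> (inv\<^bsub>GL n\<^esub> c))"
      obtain u where u: "z = u \<cdot>\<^sub>m 1\<^sub>m n"
        using center_GL_scalar[OF z] by blast
      have "transpose_mat z = z"
        unfolding u by (rule eq_matI) auto
      then have "M s \<otimes>\<^bsub>GL n\<^esub> ?L (M s) = c \<otimes>\<^bsub>GL n\<^esub> (M t \<otimes>\<^bsub>GL n\<^esub> ?L (M t)) \<otimes>\<^bsub>GL n\<^esub> inv\<^bsub>GL n\<^esub> c"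
        using eq True by (intro GL.cosquare_conjugate[OF c MG z]) (auto simp: GL.twist_def)
      moreover have "M t * ?L (M t) \<in> carrier_mat n n"
        using GL.m_closed[OF MG GL.L_closed[OF MG], of t t] by (simp add: GL_iff)
      ultimately have "mat_trace (M s * ?L (M s)) = mat_trace (M t * ?L (M t))"
        using mat_trace_conjugate[OF c] by simp
      then show "poly [:?k + 2, 0, - e:] s = poly [:?k + 2, 0, - e:] t"
        unfolding cosquare .
    qed
  qed
qed

theorem theorem1:
  fixes n :: nat and G :: "'k::idom mat monoid"
  assumes "n \<ge> 3"
    and "infinite (UNIV :: 'k set)"
    and "G = GL n \<or> G = SL n"
  shows "(\<forall>\<phi>\<in>standard_automorphisms n G. infinite (twisted_conj_classes G \<phi>)) \<and>
         (standard_automorphisms n G = auto G \<longrightarrow> R_infinity G)"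
proof -
  obtain K where G: "G = (GL n)\<lparr>carrier := K\<rparr>" and K: "subgroup K (GL n)"
    and SL: "{A \<in> carrier_mat n n. det A = 1} \<subseteq> K"
    and conj: "\<And>D A. D \<in> carrier (GL n) \<Longrightarrow> A \<in> K \<Longrightarrow> D * A * inv\<^bsub>GL n\<^esub> D \<in> K"
    and trans: "\<And>A. A \<in> K \<Longrightarrow> transpose_mat A \<in> K"
    using assms(3)
  proof
    assume G: "G = GL n"
    show thesis
    proof (rule that)
      show "G = (GL n)\<lparr>carrier := carrier (GL n)\<rparr>"
        by (simp add: G)
      show "D * A * inv\<^bsub>GL n\<^esub> D \<in> carrier (GL n)"
        if "D \<in> carrier (GL n)" "A \<in> carrier (GL n)" for D A :: "'k mat"
        using GL.m_closed[OF GL.m_closed[OF that] GL.inv_closed[OF that(1)]] by simp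
    qed (auto simp: GL.subgroup_self SL_subset_GL transpose_GL)
  next
    assume G: "G = SL n"
    show thesis
    proof (rule that)
      show "G = (GL n)\<lparr>carrier := {A \<in> carrier_mat n n. det A = 1}\<rparr>"
        by (simp add: G SL_def)
      show "D * A * inv\<^bsub>GL n\<^esub> D \<in> {A \<in> carrier_mat n n. det A = 1}"
        if "D \<in> carrier (GL n)" "A \<in> {A \<in> carrier_mat n n. det A = 1}" for D A :: "'k mat"
        using that GL.inv_closed[OF that(1)] det_conjugate[OF that(1), of A] by (auto simp: GL_iff)
    qed (auto simp: subgroup_SL det_transpose)
  qed
  have "infinite (twisted_conj_classes G \<phi>)" if "\<phi> \<in> standard_automorphisms n G" for \<phi>
    using infinite_twisted_conj_classes[OF _ assms(2) K SL]
      standard_automorphisms_mod_center[OF K SL conj trans] that assms(1) unfolding G by auto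
  then show ?thesis
    by (auto simp: R_infinity_def)
qed

end
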